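(* Let $f$ be a unate boolean function. (1) If $f$ is $\wedge$-decomposable or $\vee$-decomposable, with factors $\{f_i\}_{i=1}^k$ of its maximal such decomposition, then $L_2(f)=\min\left\{\sum_{i=1}^k L_2(f_i),\ uDNF_s(f),\ uCNF_s(f)\right\}$. (2) If $f$ is neither $\wedge$- nor $\vee$-decomposable, then $L_2(f)=\min\{uDNF_s(f),uCNF_s(f)\}$.
   Context: A boolean function is unate if it has a formula over $\{\wedge,\vee\}$ (negations only at leaves) in which each variable appears only negated or only non-negated. For $\odot\in\{\wedge,\vee\}$, $f(x_1,\dots,x_n)$ is $\odot$-decomposable if there is a partition of $\{x_1,\dots,x_n\}$ into $t>1$ nonempty disjoint blocks $X_i$ and functions $f_i$ with $f=\bigodot_{i=1}^t f_i(X_i)$; a decomposition is maximal if no $f_i$ is $\odot$-decomposable (the maximal decomposition is unique). $uDNF_s(g)$, $uCNF_s(g)$ denote the minimum number of leaves of a unate DNF, resp. unate CNF, computing $g$. For a set $U$ of leaves of a formula with lowest common ancestor $u$, the sub-formula induced by $U$ is the subtree rooted at $u$ containing exactly those sub-formulas rooted at children of $u$ that contain a leaf of $U$. A unate formula of order 2 ($UF_2$) is a unate formula over $\{\wedge,\vee\}$ with unbounded fan-in, negations only at leaves, no two adjacent gates with the same label, such that for every variable $x_i$ the sub-formula induced by the set of leaves labelled $x_i$ or $\overline{x_i}$ has depth at most 2; its size is its number of leaves. $L_2(f)$ is the minimum size of a $UF_2$ formula computing $f$. Standing assumption: $f$ depends on all its variables. *)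

theory Defs
  imports Main "HOL-Library.Sublist" "HOL-Library.Disjoint_Sets"
begin

subsection \<open>Boolean functions and decompositions\<close>

text \<open>
  A boolean function of the finite set of variables \<open>X\<close> is a predicate on assignments of
  the whole variable type whose value is determined by the restriction of the assignment to \<open>X\<close>.
  This lets functions of different sets of variables be combined without restricting their domains.
\<close>

definition bool_fun :: "'v set \<Rightarrow> (('v \<Rightarrow> bool) \<Rightarrow> bool) \<Rightarrow> bool" where
  "bool_fun X f \<longleftrightarrow> finite X \<and> (\<forall>a b. (\<forall>x\<in>X. a x = b x) \<longrightarrow> f a = f b)"

definition depends_on :: "(('v \<Rightarrow> bool) \<Rightarrow> bool) \<Rightarrow> 'v \<Rightarrow> bool" where
  "depends_on f x \<longleftrightarrow> (\<exists>a. f (a(x := True)) \<noteq> f (a(x := False)))"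

datatype connective = Conj | Disj

fun big :: "connective \<Rightarrow> 'b set \<Rightarrow> ('b \<Rightarrow> bool) \<Rightarrow> bool" where
  "big Conj I p = (\<forall>i\<in>I. p i)"
| "big Disj I p = (\<exists>i\<in>I. p i)"

text \<open>The factors are indexed by the blocks of the partition: \<open>F B\<close> is the factor on \<open>B\<close>.\<close>

definition decomposition ::
  "connective \<Rightarrow> 'v set \<Rightarrow> (('v \<Rightarrow> bool) \<Rightarrow> bool) \<Rightarrow> 'v set set \<Rightarrow>
    ('v set \<Rightarrow> ('v \<Rightarrow> bool) \<Rightarrow> bool) \<Rightarrow> bool" where
  "decomposition c X f P F \<longleftrightarrow>
     partition_on X P \<and> card P > 1 \<and> (\<forall>B\<in>P. bool_fun B (F B)) \<and>
     (\<forall>a. f a = big c P (\<lambda>B. F B a))"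

definition decomposable :: "connective \<Rightarrow> 'v set \<Rightarrow> (('v \<Rightarrow> bool) \<Rightarrow> bool) \<Rightarrow> bool" where
  "decomposable c X f \<longleftrightarrow> (\<exists>P F. decomposition c X f P F)"

definition maximal_decomposition ::
  "connective \<Rightarrow> 'v set \<Rightarrow> (('v \<Rightarrow> bool) \<Rightarrow> bool) \<Rightarrow> 'v set set \<Rightarrow>
    ('v set \<Rightarrow> ('v \<Rightarrow> bool) \<Rightarrow> bool) \<Rightarrow> bool" where
  "maximal_decomposition c X f P F \<longleftrightarrow>
     decomposition c X f P F \<and> (\<forall>B\<in>P. \<not> decomposable c B (F B))"


subsection \<open>Formulas\<close>

text \<open>\<open>Lit True x\<close> is the leaf \<open>x\<close> and \<open>Lit False x\<close> is the negated leaf.\<close>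

datatype 'v formula = Lit bool 'v | Gate connective "'v formula list"

fun eval :: "'v formula \<Rightarrow> ('v \<Rightarrow> bool) \<Rightarrow> bool" where
  "eval (Lit s x) a = (a x = s)"
| "eval (Gate Conj \<phi>s) a = (\<forall>\<phi>\<in>set \<phi>s. eval \<phi> a)"
| "eval (Gate Disj \<phi>s) a = (\<exists>\<phi>\<in>set \<phi>s. eval \<phi> a)"

fun literals :: "'v formula \<Rightarrow> (bool \<times> 'v) set" where
  "literals (Lit s x) = {(s, x)}"
| "literals (Gate c \<phi>s) = (\<Union>\<phi>\<in>set \<phi>s. literals \<phi>)"

definition variables :: "'v formula \<Rightarrow> 'v set" where
  "variables \<phi> = snd ` literals \<phi>"

fun num_leaves :: "'v formula \<Rightarrow> nat" where
  "num_leaves (Lit s x) = 1"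
| "num_leaves (Gate c \<phi>s) = (\<Sum>\<phi>\<leftarrow>\<phi>s. num_leaves \<phi>)"

text \<open>Depth is the maximal number of gates on a path, so literals have depth 0.\<close>

fun depth :: "'v formula \<Rightarrow> nat" where
  "depth (Lit s x) = 0"
| "depth (Gate c \<phi>s) = Suc (Max (insert 0 (depth ` set \<phi>s)))"

text \<open>Every gate has fan-in at least 2; in particular there are no constants.\<close>

fun proper_gates :: "'v formula \<Rightarrow> bool" where
  "proper_gates (Lit s x) = True"
| "proper_gates (Gate c \<phi>s) = (length \<phi>s \<ge> 2 \<and> (\<forall>\<phi>\<in>set \<phi>s. proper_gates \<phi>))"

definition unate_formula :: "'v formula \<Rightarrow> bool" where
  "unate_formula \<phi> \<longleftrightarrow>
     proper_gates \<phi> \<and> (\<forall>x. \<not> ((True, x) \<in> literals \<phi> \<and> (False, x) \<in> literals \<phi>))"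

definition computes :: "'v set \<Rightarrow> 'v formula \<Rightarrow> (('v \<Rightarrow> bool) \<Rightarrow> bool) \<Rightarrow> bool" where
  "computes X \<phi> f \<longleftrightarrow> variables \<phi> \<subseteq> X \<and> (\<forall>a. eval \<phi> a = f a)"

definition unate :: "'v set \<Rightarrow> (('v \<Rightarrow> bool) \<Rightarrow> bool) \<Rightarrow> bool" where
  "unate X f \<longleftrightarrow> (\<exists>\<phi>. unate_formula \<phi> \<and> computes X \<phi> f)"


subsection \<open>Unate normal forms\<close>

text \<open>Since gates have fan-in at least 2, one-literal terms and one-term normal forms appear
  without their gate.\<close>

definition is_flat :: "connective \<Rightarrow> 'v formula \<Rightarrow> bool" where
  "is_flat c \<phi> \<longleftrightarrow>
     (\<exists>s x. \<phi> = Lit s x) \<or>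
     (\<exists>\<phi>s. \<phi> = Gate c \<phi>s \<and> (\<forall>\<psi>\<in>set \<phi>s. \<exists>s x. \<psi> = Lit s x))"

definition is_DNF :: "'v formula \<Rightarrow> bool" where
  "is_DNF \<phi> \<longleftrightarrow>
     is_flat Conj \<phi> \<or> (\<exists>\<phi>s. \<phi> = Gate Disj \<phi>s \<and> (\<forall>\<psi>\<in>set \<phi>s. is_flat Conj \<psi>))"

definition is_CNF :: "'v formula \<Rightarrow> bool" where
  "is_CNF \<phi> \<longleftrightarrow>
     is_flat Disj \<phi> \<or> (\<exists>\<phi>s. \<phi> = Gate Conj \<phi>s \<and> (\<forall>\<psi>\<in>set \<phi>s. is_flat Disj \<psi>))"

definition uDNF_size :: "'v set \<Rightarrow> (('v \<Rightarrow> bool) \<Rightarrow> bool) \<Rightarrow> nat" where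
  "uDNF_size X g =
     (LEAST s. \<exists>\<phi>. unate_formula \<phi> \<and> is_DNF \<phi> \<and> computes X \<phi> g \<and> num_leaves \<phi> = s)"

definition uCNF_size :: "'v set \<Rightarrow> (('v \<Rightarrow> bool) \<Rightarrow> bool) \<Rightarrow> nat" where
  "uCNF_size X g =
     (LEAST s. \<exists>\<phi>. unate_formula \<phi> \<and> is_CNF \<phi> \<and> computes X \<phi> g \<and> num_leaves \<phi> = s)"


subsection \<open>Unate formulas of order 2\<close>

text \<open>A node is addressed by the list of child indices on the path from the root to it, so the
  lowest common ancestor of a nonempty set of leaves is its longest common prefix.\<close>

lemma size_nth_less_size_list [termination_simp]:
  "i < length xs \<Longrightarrow> size (xs ! i) < Suc (size_list size xs)"
  by (meson le_imp_less_Suc nth_mem order_refl size_list_estimation')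

fun leaves :: "'v formula \<Rightarrow> nat list set" where
  "leaves (Lit s x) = {[]}"
| "leaves (Gate c \<phi>s) = (\<Union>i\<in>{..<length \<phi>s}. (#) i ` leaves (\<phi>s ! i))"

fun subformula_at :: "'v formula \<Rightarrow> nat list \<Rightarrow> 'v formula" where
  "subformula_at \<phi> [] = \<phi>"
| "subformula_at (Lit s x) (i # p) = Lit s x"
| "subformula_at (Gate c \<phi>s) (i # p) = subformula_at (\<phi>s ! i) p"

definition induced :: "'v formula \<Rightarrow> nat list set \<Rightarrow> 'v formula" where
  "induced \<phi> U =
     (let u = Longest_common_prefix U in
      case subformula_at \<phi> u of
        Lit s x \<Rightarrow> Lit s x
      | Gate c \<phi>s \<Rightarrow> Gate c (map ((!) \<phi>s) (filter (\<lambda>i. \<exists>p. u @ i # p \<in> U) [0..<length \<phi>s])))"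

definition leaves_labelled :: "'v formula \<Rightarrow> 'v \<Rightarrow> nat list set" where
  "leaves_labelled \<phi> x = {p \<in> leaves \<phi>. \<exists>s. subformula_at \<phi> p = Lit s x}"

fun alternating :: "'v formula \<Rightarrow> bool" where
  "alternating (Lit s x) = True"
| "alternating (Gate c \<phi>s) = (\<forall>\<phi>\<in>set \<phi>s. alternating \<phi> \<and> (\<forall>\<psi>s. \<phi> \<noteq> Gate c \<psi>s))"

definition UF2 :: "'v formula \<Rightarrow> bool" where
  "UF2 \<phi> \<longleftrightarrow>
     unate_formula \<phi> \<and> alternating \<phi> \<and>
     (\<forall>x\<in>variables \<phi>. depth (induced \<phi> (leaves_labelled \<phi> x)) \<le> 2)"

definition L2 :: "'v set \<Rightarrow> (('v \<Rightarrow> bool) \<Rightarrow> bool) \<Rightarrow> nat" where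
  "L2 X f = (LEAST s. \<exists>\<phi>. UF2 \<phi> \<and> computes X \<phi> f \<and> num_leaves \<phi> = s)"

end

theory Submission
  imports Defs
begin

text \<open>
  Fixing the variables outside a block \<open>B\<close> of a decomposition so that all other factors become neutral,
  and propagating the constants, turns an order-2 formula for \<open>f\<close> into an order-2 formula for the
  factor on \<open>B\<close> whose leaves are leaves of the original formula labelled by variables of \<open>B\<close>. Hence
  the sizes \<open>L2\<close> of the factors of any decomposition add up to at most \<open>L2\<close> of \<open>f\<close>, and joining optimal
  formulas for the factors gives equality: in the decomposable case the minimum is always attained
  by the sum.

  In an order-2 formula a child of the root of depth at least 2 shares no variable with its
  siblings, so it splits off a factor. If \<open>f\<close> is not decomposable, all children of the root therefore
  have depth at most 1, and the formula is a DNF or a CNF.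
\<close>


subsection \<open>A recursive form of the order-2 condition\<close>

lemma variables_Gate [simp]: "variables (Gate c \<phi>s) = (\<Union>\<phi>\<in>set \<phi>s. variables \<phi>)"
  by (auto simp: variables_def)

lemma variables_Lit [simp]: "variables (Lit s x) = {x}"
  by (simp add: variables_def)

lemma depth_Gate_le_iff [simp]: "depth (Gate c \<phi>s) \<le> Suc n \<longleftrightarrow> (\<forall>\<phi>\<in>set \<phi>s. depth \<phi> \<le> n)"
  by simp

lemma depth_Gate_ne_0 [simp]: "0 < depth (Gate c \<phi>s)"
  by simp

declare depth.simps(2) [simp del]

lemma depth_eq_0_iff: "depth \<phi> = 0 \<longleftrightarrow> (\<exists>s x. \<phi> = Lit s x)"
  by (cases \<phi>) (auto simp: depth.simps(2))

lemma depth_child_less: "\<phi> \<in> set \<phi>s \<Longrightarrow> depth \<phi> < depth (Gate c \<phi>s)"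
  by (simp add: depth.simps(2) less_Suc_eq_le)

text \<open>If two children of a gate share a variable, this gate is the lowest common ancestor of
  the variable's leaves and the induced sub-formula keeps both children whole. It has depth at most
  2 only if they have depth at most 1.\<close>

definition compatible :: "'v formula \<Rightarrow> 'v formula \<Rightarrow> bool" where
  "compatible \<phi> \<psi> \<longleftrightarrow> variables \<phi> \<inter> variables \<psi> = {} \<or> depth \<phi> \<le> 1 \<and> depth \<psi> \<le> 1"

text \<open>\<open>sorted_wrt\<close> speaks of pairs of positions, so two equal children at
  different positions count as two siblings.\<close>

fun order2 :: "'v formula \<Rightarrow> bool" where
  "order2 (Lit s x) = True"
| "order2 (Gate c \<phi>s) = ((\<forall>\<phi>\<in>set \<phi>s. order2 \<phi>) \<and> sorted_wrt compatible \<phi>s)"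

lemma compatible_sym: "compatible \<phi> \<psi> \<Longrightarrow> compatible \<psi> \<phi>"
  by (auto simp: compatible_def)

lemma sorted_wrt_compatible_iff:
  "sorted_wrt compatible \<phi>s \<longleftrightarrow>
     (\<forall>i<length \<phi>s. \<forall>j<length \<phi>s. i \<noteq> j \<longrightarrow> compatible (\<phi>s ! i) (\<phi>s ! j))"
proof
  assume s: "sorted_wrt compatible \<phi>s"
  show "\<forall>i<length \<phi>s. \<forall>j<length \<phi>s. i \<noteq> j \<longrightarrow> compatible (\<phi>s ! i) (\<phi>s ! j)"
  proof (intro allI impI)
    fix i j assume "i < length \<phi>s" "j < length \<phi>s" "i \<noteq> j"
    then show "compatible (\<phi>s ! i) (\<phi>s ! j)"
      using s compatible_sym by (cases i j rule: linorder_cases) (auto simp: sorted_wrt_iff_nth_less)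
  qed
qed (simp add: sorted_wrt_iff_nth_less)

lemma sorted_wrt_compatible_if_depth_le:
  assumes "\<forall>\<phi>\<in>set \<phi>s. depth \<phi> \<le> 1"
  shows "sorted_wrt compatible \<phi>s"
  using assms by (auto simp: sorted_wrt_compatible_iff compatible_def)

lemma order2_if_depth_le_1: "depth \<phi> \<le> 1 \<Longrightarrow> order2 \<phi>"
proof (cases \<phi>)
  case (Gate c \<phi>s)
  assume "depth \<phi> \<le> 1"
  then have depth_0: "\<forall>\<psi>\<in>set \<phi>s. depth \<psi> = 0"
    using Gate by simp
  then have "\<forall>\<psi>\<in>set \<phi>s. order2 \<psi>"
    by (metis depth_eq_0_iff order2.simps(1))
  moreover have "sorted_wrt compatible \<phi>s"
    using depth_0 by (intro sorted_wrt_compatible_if_depth_le) simp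
  ultimately show ?thesis
    unfolding Gate by simp
qed simp

lemma order2_if_depth_le_2: "depth \<phi> \<le> 2 \<Longrightarrow> order2 \<phi>"
proof (cases \<phi>)
  case (Gate c \<phi>s)
  assume "depth \<phi> \<le> 2"
  then have "\<forall>\<psi>\<in>set \<phi>s. depth \<psi> \<le> 1"
    unfolding Gate numeral_2_eq_2 by simp
  then show ?thesis
    unfolding Gate by (auto intro!: sorted_wrt_compatible_if_depth_le order2_if_depth_le_1)
qed simp

section \<open>Leaf addresses and induced sub-formulas\<close>

lemma leaves_labelled_Lit: "leaves_labelled (Lit s x) y = (if x = y then {[]} else {})"
  by (auto simp: leaves_labelled_def)

lemma leaves_labelled_Gate:
  "leaves_labelled (Gate c \<phi>s) x = (\<Union>i<length \<phi>s. (#) i ` leaves_labelled (\<phi>s ! i) x)"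
  by (auto simp: leaves_labelled_def)

lemma leaves_labelled_nonempty_iff: "leaves_labelled \<phi> x \<noteq> {} \<longleftrightarrow> x \<in> variables \<phi>"
proof (induction \<phi>)
  case (Gate c \<phi>s)
  then have "leaves_labelled (\<phi>s ! i) x \<noteq> {} \<longleftrightarrow> x \<in> variables (\<phi>s ! i)" if "i < length \<phi>s" for i
    using that by simp
  moreover have "variables (Gate c \<phi>s) = (\<Union>i<length \<phi>s. variables (\<phi>s ! i))"
    by (auto simp: in_set_conv_nth) (metis nth_mem)
  ultimately show ?case
    by (auto simp: leaves_labelled_Gate)
qed (auto simp: leaves_labelled_Lit)

text \<open>Every address of a leaf labelled by \<open>x\<close> begins with \<open>i\<close>, hence
  so does their longest common prefix, and the lowest common ancestor lies inside this
  child.\<close>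

lemma induced_leaves_labelled_unique:
  assumes i: "i < length \<phi>s" "x \<in> variables (\<phi>s ! i)"
    and unique: "\<And>j. j < length \<phi>s \<Longrightarrow> x \<in> variables (\<phi>s ! j) \<Longrightarrow> j = i"
  shows "induced (Gate c \<phi>s) (leaves_labelled (Gate c \<phi>s) x) =
    induced (\<phi>s ! i) (leaves_labelled (\<phi>s ! i) x)"
proof -
  let ?U = "leaves_labelled (\<phi>s ! i) x"
  have "(#) j ` leaves_labelled (\<phi>s ! j) x \<subseteq> (#) i ` ?U" if "j < length \<phi>s" for j
  proof (cases "j = i")
    case False
    then have "leaves_labelled (\<phi>s ! j) x = {}"
      using unique[OF that] leaves_labelled_nonempty_iff[of "\<phi>s ! j" x] by blast
    then show ?thesis
      by simp
  qed simp
  then have U: "leaves_labelled (Gate c \<phi>s) x = (#) i ` ?U"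
    unfolding leaves_labelled_Gate using i(1) by blast
  have "?U \<noteq> {}"
    using i(2) by (simp add: leaves_labelled_nonempty_iff)
  then have lcp: "Longest_common_prefix ((#) i ` ?U) = i # Longest_common_prefix ?U"
    by (rule Longest_common_prefix_image_Cons)
  have Cons_in: "i # p \<in> (#) i ` ?U \<longleftrightarrow> p \<in> ?U" for p
    by auto
  show ?thesis
    unfolding induced_def U lcp Let_def by (simp only: append_Cons Cons_in subformula_at.simps(3))
qed

text \<open>An address beginning with \<open>i\<close> and one beginning with \<open>j\<close> have
  only the empty common prefix, so the induced sub-formula is the root gate with exactly the
  children that contain \<open>x\<close>.\<close>

lemma depth_induced_leaves_labelled_shared:
  assumes ij: "i < length \<phi>s" "j < length \<phi>s" "i \<noteq> j"
    and x: "x \<in> variables (\<phi>s ! i)" "x \<in> variables (\<phi>s ! j)"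
  shows "depth (induced (Gate c \<phi>s) (leaves_labelled (Gate c \<phi>s) x)) \<le> 2 \<longleftrightarrow>
    (\<forall>\<phi>\<in>set \<phi>s. x \<in> variables \<phi> \<longrightarrow> depth \<phi> \<le> 1)"
proof -
  let ?U = "leaves_labelled (Gate c \<phi>s) x"
  obtain p q where "p \<in> leaves_labelled (\<phi>s ! i) x" "q \<in> leaves_labelled (\<phi>s ! j) x"
    using x[folded leaves_labelled_nonempty_iff] by blast
  then have "i # p \<in> ?U" "j # q \<in> ?U"
    using ij(1,2) by (auto simp: leaves_labelled_Gate)
  then have lcp: "Longest_common_prefix ?U = []"
    using ij(3) by (rule Longest_common_prefix_eq_Nil)
  have "(\<exists>p. k # p \<in> ?U) \<longleftrightarrow> x \<in> variables (\<phi>s ! k)" if "k < length \<phi>s" for k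
    using that unfolding leaves_labelled_Gate leaves_labelled_nonempty_iff[symmetric] by auto
  then have "filter (\<lambda>k. \<exists>p. k # p \<in> ?U) [0..<length \<phi>s] =
      filter (\<lambda>k. x \<in> variables (\<phi>s ! k)) [0..<length \<phi>s]"
    by (intro filter_cong) auto
  then have "induced (Gate c \<phi>s) ?U =
      Gate c (map ((!) \<phi>s) (filter (\<lambda>k. x \<in> variables (\<phi>s ! k)) [0..<length \<phi>s]))"
    unfolding induced_def lcp Let_def by simp
  then have "depth (induced (Gate c \<phi>s) ?U) \<le> Suc 1 \<longleftrightarrow>
      (\<forall>k<length \<phi>s. x \<in> variables (\<phi>s ! k) \<longrightarrow> depth (\<phi>s ! k) \<le> 1)"
    unfolding depth_Gate_le_iff by auto
  then show ?thesis
    unfolding numeral_2_eq_2 One_nat_def by (metis in_set_conv_nth)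
qed

text \<open>Induction on the formula, distinguishing whether a variable occurs below one child of
  the root or below several: the first case is passed on to that child, the second is
  \<open>compatible\<close>.\<close>

lemma order2_iff_depth_induced_le:
  "order2 \<phi> \<longleftrightarrow> (\<forall>x\<in>variables \<phi>. depth (induced \<phi> (leaves_labelled \<phi> x)) \<le> 2)"
proof (induction \<phi>)
  case (Lit s x)
  then show ?case
    by (simp add: induced_def leaves_labelled_Lit Longest_common_prefix_Nil)
next
  case (Gate c \<phi>s)
  let ?D = "\<lambda>\<phi> x. depth (induced \<phi> (leaves_labelled \<phi> x)) \<le> 2"
  have IH: "order2 (\<phi>s ! i) \<longleftrightarrow> (\<forall>x\<in>variables (\<phi>s ! i). ?D (\<phi>s ! i) x)" if "i < length \<phi>s" for i
    using Gate.IH that by simp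
  show ?case
  proof
    assume o: "order2 (Gate c \<phi>s)"
    then have compat: "compatible (\<phi>s ! i) (\<phi>s ! j)"
      if "i < length \<phi>s" "j < length \<phi>s" "i \<noteq> j" for i j
      using that by (simp add: sorted_wrt_compatible_iff)
    show "\<forall>x\<in>variables (Gate c \<phi>s). ?D (Gate c \<phi>s) x"
    proof
      fix x assume "x \<in> variables (Gate c \<phi>s)"
      then obtain i where i: "i < length \<phi>s" "x \<in> variables (\<phi>s ! i)"
        by (auto simp: in_set_conv_nth)
      show "?D (Gate c \<phi>s) x"
      proof (cases "\<exists>j<length \<phi>s. j \<noteq> i \<and> x \<in> variables (\<phi>s ! j)")
        case True
        then obtain j where j: "j < length \<phi>s" "j \<noteq> i" "x \<in> variables (\<phi>s ! j)"
          by blast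
        have "depth \<phi> \<le> 1" if \<phi>: "\<phi> \<in> set \<phi>s" "x \<in> variables \<phi>" for \<phi>
        proof -
          obtain k where k: "k < length \<phi>s" "\<phi> = \<phi>s ! k"
            using \<phi>(1) by (auto simp: in_set_conv_nth)
          \<comment> \<open>Whichever child is considered, another one contains \<open>x\<close>:
            the one at \<open>j\<close> if \<open>k = i\<close>, the one at \<open>i\<close>
            otherwise.\<close>
          obtain l where "l < length \<phi>s" "l \<noteq> k" "x \<in> variables (\<phi>s ! l)"
            using i j by (cases "k = i") auto
          then show ?thesis
            using compat[of k l] k \<phi>(2) by (auto simp: compatible_def)
        qed
        then show ?thesis
          using depth_induced_leaves_labelled_shared i j by metis
      next
        case False
        then have "induced (Gate c \<phi>s) (leaves_labelled (Gate c \<phi>s) x) =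
            induced (\<phi>s ! i) (leaves_labelled (\<phi>s ! i) x)"
          using i by (intro induced_leaves_labelled_unique) auto
        then show ?thesis
          using IH[OF i(1)] i o by simp
      qed
    qed
  next
    assume D: "\<forall>x\<in>variables (Gate c \<phi>s). ?D (Gate c \<phi>s) x"
    have shared: "depth (\<phi>s ! i) \<le> 1"
      if "i < length \<phi>s" "j < length \<phi>s" "i \<noteq> j" "x \<in> variables (\<phi>s ! i)" "x \<in> variables (\<phi>s ! j)"
      for i j x
    proof -
      have "x \<in> variables (Gate c \<phi>s)"
        using that by auto
      then show ?thesis
        using D depth_induced_leaves_labelled_shared[OF that, of c] that by auto
    qed
    have "order2 (\<phi>s ! i)" if i: "i < length \<phi>s" for i
    \<comment> \<open>A child of depth at least 2 has no variable in common with a sibling, so what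
      its variables induce in the whole formula is already induced in the child.\<close>
    proof (cases "depth (\<phi>s ! i) \<le> 1")
      case True
      then show ?thesis by (rule order2_if_depth_le_1)
    next
      case False
      have "?D (\<phi>s ! i) x" if x: "x \<in> variables (\<phi>s ! i)" for x
      proof -
        have "induced (Gate c \<phi>s) (leaves_labelled (Gate c \<phi>s) x) =
            induced (\<phi>s ! i) (leaves_labelled (\<phi>s ! i) x)"
          using shared False i x by (intro induced_leaves_labelled_unique) metis+
        moreover have "x \<in> variables (Gate c \<phi>s)"
          using i x by auto
        ultimately show ?thesis
          using D by metis
      qed
      then show ?thesis
        using IH[OF i] by blast
    qed
    moreover have "sorted_wrt compatible \<phi>s"
      unfolding sorted_wrt_compatible_iff compatible_def using shared by (metis disjoint_iff)
    ultimately show "order2 (Gate c \<phi>s)"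
      by (auto simp: in_set_conv_nth)
  qed
qed

lemma UF2_iff: "UF2 \<phi> \<longleftrightarrow> unate_formula \<phi> \<and> alternating \<phi> \<and> order2 \<phi>"
  by (simp add: UF2_def order2_iff_depth_induced_le)


subsection \<open>Joining formulas\<close>

fun dual :: "connective \<Rightarrow> connective" where
  "dual Conj = Disj"
| "dual Disj = Conj"

lemma dual_neq [simp]: "dual c \<noteq> c" "c \<noteq> dual c"
  by (cases c; simp)+

lemma eq_dual_iff: "d = dual c \<longleftrightarrow> d \<noteq> c"
  by (cases c; cases d) simp_all

text \<open>Empty gates stand for the two constants: they are the neutral elements of their connective.\<close>

definition is_constant :: "'v formula \<Rightarrow> bool" where
  "is_constant \<phi> \<longleftrightarrow> (\<exists>c. \<phi> = Gate c [])"

lemma variables_constant: "is_constant \<phi> \<Longrightarrow> variables \<phi> = {}"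
  by (auto simp: is_constant_def)

text \<open>\<open>c = Disj\<close> is the truth value absorbing for \<open>c\<close>, which lets both connectives be treated at
  once.\<close>

lemma eval_Gate_iff: "eval (Gate c \<phi>s) a = (c = Disj) \<longleftrightarrow> (\<exists>\<phi>\<in>set \<phi>s. eval \<phi> a = (c = Disj))"
  by (cases c) auto

lemma eval_Gate_dual_iff:
  "eval (Gate (dual c) \<phi>s) a = (c = Disj) \<longleftrightarrow> (\<forall>\<phi>\<in>set \<phi>s. eval \<phi> a = (c = Disj))"
  by (cases c) auto

lemma big_iff: "big c I p = (c = Disj) \<longleftrightarrow> (\<exists>i\<in>I. p i = (c = Disj))"
  by (cases c) auto

text \<open>Merging a child with the same label restores alternation. The neutral constant
  \<open>Gate c []\<close> is mapped to the empty list and thereby disappears.\<close>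

fun flatten :: "connective \<Rightarrow> 'v formula \<Rightarrow> 'v formula list" where
  "flatten c (Lit s x) = [Lit s x]"
| "flatten c (Gate d \<phi>s) = (if d = c then \<phi>s else [Gate d \<phi>s])"

text \<open>A gate constructor that simplifies: an absorbing constant takes over the whole gate, and
  a single remaining child replaces its gate, so no gate of fan-in 1 is created.\<close>

definition join :: "connective \<Rightarrow> 'v formula list \<Rightarrow> 'v formula" where
  "join c \<phi>s =
     (if Gate (dual c) [] \<in> set \<phi>s then Gate (dual c) []
      else case concat (map (flatten c) \<phi>s) of [\<phi>] \<Rightarrow> \<phi> | \<psi>s \<Rightarrow> Gate c \<psi>s)"

lemma join_cases:
  assumes "Gate (dual c) [] \<in> set \<phi>s \<Longrightarrow> Q (Gate (dual c) [])"
    and "\<And>\<phi>. Gate (dual c) [] \<notin> set \<phi>s \<Longrightarrow> concat (map (flatten c) \<phi>s) = [\<phi>] \<Longrightarrow> Q \<phi>"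
    and "Gate (dual c) [] \<notin> set \<phi>s \<Longrightarrow> length (concat (map (flatten c) \<phi>s)) \<noteq> 1 \<Longrightarrow>
      Q (Gate c (concat (map (flatten c) \<phi>s)))"
  shows "Q (join c \<phi>s)"
proof -
  define \<psi>s where "\<psi>s = concat (map (flatten c) \<phi>s)"
  show ?thesis
    using assms unfolding join_def \<psi>s_def[symmetric] by (auto split: list.split)
qed

lemma eval_flatten_iff: "(\<exists>\<psi>\<in>set (flatten c \<phi>). eval \<psi> a = (c = Disj)) \<longleftrightarrow> eval \<phi> a = (c = Disj)"
proof (cases \<phi>)
  case (Gate d \<phi>s)
  then show ?thesis
    using eval_Gate_iff[of c \<phi>s a] by (cases "d = c") simp_all
qed simp

lemma eval_Gate_flatten:
  "eval (Gate c (concat (map (flatten c) \<phi>s))) a = eval (Gate c \<phi>s) a"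
proof -
  have "eval (Gate c (concat (map (flatten c) \<phi>s))) a = (c = Disj) \<longleftrightarrow>
      (\<exists>\<phi>\<in>set \<phi>s. \<exists>\<psi>\<in>set (flatten c \<phi>). eval \<psi> a = (c = Disj))"
    unfolding eval_Gate_iff by simp
  also have "\<dots> \<longleftrightarrow> eval (Gate c \<phi>s) a = (c = Disj)"
    by (simp only: eval_flatten_iff eval_Gate_iff)
  finally show ?thesis
    by argo
qed

lemma eval_join [simp]: "eval (join c \<phi>s) a = eval (Gate c \<phi>s) a"
proof (rule join_cases[of c \<phi>s])
  assume "Gate (dual c) [] \<in> set \<phi>s"
  then have "eval (Gate c \<phi>s) a = (c = Disj)"
    unfolding eval_Gate_iff by (rule rev_bexI) (cases c; simp)
  moreover have "eval (Gate (dual c) []) a = (c = Disj)"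
    by (cases c) simp_all
  ultimately show "eval (Gate (dual c) []) a = eval (Gate c \<phi>s) a"
    by argo
next
  fix \<phi> assume "concat (map (flatten c) \<phi>s) = [\<phi>]"
  moreover have "eval (Gate c [\<phi>]) a = eval \<phi> a"
    by (cases c) simp_all
  ultimately show "eval \<phi> a = eval (Gate c \<phi>s) a"
    by (metis eval_Gate_flatten)
qed (simp add: eval_Gate_flatten)

lemma literals_flatten: "\<psi> \<in> set (flatten c \<phi>) \<Longrightarrow> literals \<psi> \<subseteq> literals \<phi>"
  by (cases \<phi>) (auto split: if_splits)

lemma literals_join: "literals (join c \<phi>s) \<subseteq> (\<Union>\<phi>\<in>set \<phi>s. literals \<phi>)"
proof -
  have *: "(\<Union>\<psi>\<in>set (concat (map (flatten c) \<phi>s)). literals \<psi>) \<subseteq> (\<Union>\<phi>\<in>set \<phi>s. literals \<phi>)"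
    using literals_flatten by fastforce
  show ?thesis
  proof (rule join_cases[of c \<phi>s])
    fix \<phi> assume "concat (map (flatten c) \<phi>s) = [\<phi>]"
    then show "literals \<phi> \<subseteq> (\<Union>\<phi>\<in>set \<phi>s. literals \<phi>)"
      using * by simp
  qed (use * in simp_all)
qed

lemma num_leaves_flatten [simp]: "(\<Sum>\<psi>\<leftarrow>flatten c \<phi>. num_leaves \<psi>) = num_leaves \<phi>"
  by (cases \<phi>) auto

lemma num_leaves_join: "num_leaves (join c \<phi>s) \<le> (\<Sum>\<phi>\<leftarrow>\<phi>s. num_leaves \<phi>)"
proof -
  have *: "(\<Sum>\<psi>\<leftarrow>concat (map (flatten c) \<phi>s). num_leaves \<psi>) = (\<Sum>\<phi>\<leftarrow>\<phi>s. num_leaves \<phi>)"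
    by (induction \<phi>s) auto
  show ?thesis
  proof (rule join_cases[of c \<phi>s])
    fix \<phi> assume "concat (map (flatten c) \<phi>s) = [\<phi>]"
    then show "num_leaves \<phi> \<le> (\<Sum>\<phi>\<leftarrow>\<phi>s. num_leaves \<phi>)"
      using * by simp
  qed (use * in simp_all)
qed

lemma depth_flatten: "\<psi> \<in> set (flatten c \<phi>) \<Longrightarrow> depth \<psi> \<le> depth \<phi>"
  by (cases \<phi>) (auto split: if_splits intro: less_imp_le depth_child_less)

lemma flatten_constant: "is_constant \<phi> \<Longrightarrow> \<phi> \<noteq> Gate (dual c) [] \<Longrightarrow> flatten c \<phi> = []"
  by (auto simp: is_constant_def eq_dual_iff)

text \<open>As an empty gate a constant has depth 1, which may exceed \<open>n\<close>. It never
  survives as a child, because it either absorbs the gate or is flattened away.\<close>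

lemma depth_join:
  assumes "\<forall>\<phi>\<in>set \<phi>s. is_constant \<phi> \<or> depth \<phi> \<le> n"
  shows "is_constant (join c \<phi>s) \<or> depth (join c \<phi>s) \<le> Suc n"
proof -
  have *: "\<forall>\<psi>\<in>set (concat (map (flatten c) \<phi>s)). depth \<psi> \<le> n" if "Gate (dual c) [] \<notin> set \<phi>s"
  proof
    fix \<psi> assume "\<psi> \<in> set (concat (map (flatten c) \<phi>s))"
    then obtain \<phi> where \<phi>: "\<phi> \<in> set \<phi>s" "\<psi> \<in> set (flatten c \<phi>)"
      by auto
    then have "\<not> is_constant \<phi>"
      using flatten_constant that by (metis empty_iff list.set(1))
    then show "depth \<psi> \<le> n"
      using assms \<phi> depth_flatten by fastforce
  qed
  show ?thesis
  proof (rule join_cases[of c \<phi>s])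
    fix \<phi> assume "Gate (dual c) [] \<notin> set \<phi>s" "concat (map (flatten c) \<phi>s) = [\<phi>]"
    then show "is_constant \<phi> \<or> depth \<phi> \<le> Suc n"
      using * by simp
  next
    assume "Gate (dual c) [] \<notin> set \<phi>s"
    then show "is_constant (Gate c (concat (map (flatten c) \<phi>s))) \<or>
        depth (Gate c (concat (map (flatten c) \<phi>s))) \<le> Suc n"
      unfolding depth_Gate_le_iff using * by simp
  qed (auto simp: is_constant_def)
qed

text \<open>The invariant of \<open>join\<close>. Constants form a separate case because empty gates
  violate \<open>proper_gates\<close>; polarities are tracked separately through
  \<open>literals\<close>.\<close>

definition reduced :: "'v formula \<Rightarrow> bool" where
  "reduced \<phi> \<longleftrightarrow> is_constant \<phi> \<or> proper_gates \<phi> \<and> alternating \<phi> \<and> order2 \<phi>"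

lemma compatible_mono:
  assumes "compatible \<phi> \<psi>"
    and "variables \<phi>' \<subseteq> variables \<phi>" "depth \<phi>' \<le> depth \<phi>"
    and "variables \<psi>' \<subseteq> variables \<psi>" "depth \<psi>' \<le> depth \<psi>"
  shows "compatible \<phi>' \<psi>'"
  using assms unfolding compatible_def by (auto intro: order_trans)

lemma variables_flatten: "\<psi> \<in> set (flatten c \<phi>) \<Longrightarrow> variables \<psi> \<subseteq> variables \<phi>"
  unfolding variables_def by (intro image_mono literals_flatten)

text \<open>Formulas from different children inherit compatibility, since flattening enlarges
  neither variables nor depth; formulas from the same child are compatible by the second
  assumption.\<close>

lemma sorted_wrt_compatible_flatten:
  assumes "sorted_wrt compatible \<phi>s" "\<forall>\<phi>\<in>set \<phi>s. sorted_wrt compatible (flatten c \<phi>)"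
  shows "sorted_wrt compatible (concat (map (flatten c) \<phi>s))"
  using assms
proof (induction \<phi>s)
  case (Cons \<phi> \<phi>s)
  have "compatible \<psi> \<psi>'"
    if "\<psi> \<in> set (flatten c \<phi>)" "\<phi>' \<in> set \<phi>s" "\<psi>' \<in> set (flatten c \<phi>')" for \<psi> \<phi>' \<psi>'
  proof (rule compatible_mono)
    show "compatible \<phi> \<phi>'"
      using Cons.prems(1) that(2) by simp
  qed (use that in \<open>simp_all add: variables_flatten depth_flatten\<close>)
  then show ?case
    using Cons by (auto simp: sorted_wrt_append)
qed simp

lemma reduced_join:
  assumes red: "\<forall>\<phi>\<in>set \<phi>s. reduced \<phi>" and compat: "sorted_wrt compatible \<phi>s"
  shows "reduced (join c \<phi>s)"
proof (cases "Gate (dual c) [] \<in> set \<phi>s")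
  case True
  then show ?thesis
    by (auto simp: join_def reduced_def is_constant_def)
next
  case False
  have flat: "sorted_wrt compatible (flatten c \<phi>) \<and> (\<forall>\<psi>\<in>set (flatten c \<phi>).
      proper_gates \<psi> \<and> alternating \<psi> \<and> order2 \<psi> \<and> (\<forall>\<chi>s. \<psi> \<noteq> Gate c \<chi>s))"
    if "\<phi> \<in> set \<phi>s" for \<phi>
  proof (cases "is_constant \<phi>")
    case True
    then have "flatten c \<phi> = []"
      using False that by (metis flatten_constant)
    then show ?thesis
      by simp
  next
    case False
    then have "proper_gates \<phi>" "alternating \<phi>" "order2 \<phi>"
      using red that by (auto simp: reduced_def)
    then show ?thesis
      by (cases \<phi>) auto
  qed
  define \<psi>s where "\<psi>s = concat (map (flatten c) \<phi>s)"
  have \<psi>s: "proper_gates \<psi> \<and> alternating \<psi> \<and> order2 \<psi> \<and> (\<forall>\<chi>s. \<psi> \<noteq> Gate c \<chi>s)"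
    if "\<psi> \<in> set \<psi>s" for \<psi>
    using that flat unfolding \<psi>s_def by auto
  have "sorted_wrt compatible \<psi>s"
    unfolding \<psi>s_def using flat compat by (intro sorted_wrt_compatible_flatten) auto
  \<comment> \<open>Length 0 gives a constant; every other length except 1 gives fan-in at least
    2.\<close>
  then have "reduced (Gate c \<psi>s)" if "length \<psi>s \<noteq> 1"
    using that \<psi>s by (cases \<psi>s) (auto simp: reduced_def is_constant_def Suc_le_eq)
  then show ?thesis
    using False \<psi>s
    by (intro join_cases[of c \<phi>s reduced]) (auto simp: \<psi>s_def reduced_def)
qed

lemma reduced_nonconstantD:
  assumes "reduced \<phi>" "eval \<phi> a \<noteq> eval \<phi> b"
  shows "proper_gates \<phi>" "alternating \<phi>" "order2 \<phi>"
proof -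
  have "eval (Gate c []) a = eval (Gate c []) b" for c :: connective
    by (cases c) simp_all
  then have "\<not> is_constant \<phi>"
    using assms(2) by (auto simp: is_constant_def)
  then show "proper_gates \<phi>" "alternating \<phi>" "order2 \<phi>"
    using assms(1) by (auto simp: reduced_def)
qed


subsection \<open>Restricting a formula to a set of variables\<close>

text \<open>Variables outside \<open>V\<close> are fixed by \<open>\<rho>\<close>. Their leaves
  become constants, which \<open>join\<close> propagates upwards.\<close>

fun restrict :: "'v set \<Rightarrow> ('v \<Rightarrow> bool) \<Rightarrow> 'v formula \<Rightarrow> 'v formula" where
  "restrict V \<rho> (Lit s x) =
     (if x \<in> V then Lit s x else Gate (if \<rho> x = s then Conj else Disj) [])"
| "restrict V \<rho> (Gate c \<phi>s) = join c (map (restrict V \<rho>) \<phi>s)"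

lemma eval_restrict: "eval (restrict V \<rho> \<phi>) a = eval \<phi> (override_on \<rho> a V)"
proof (induction \<phi>)
  case (Gate c \<phi>s)
  then show ?case
    by (cases c) auto
qed (auto simp: override_on_def)

lemma literals_restrict: "literals (restrict V \<rho> \<phi>) \<subseteq> {(s, x) \<in> literals \<phi>. x \<in> V}"
proof (induction \<phi>)
  case (Gate c \<phi>s)
  then show ?case
    using literals_join[of c "map (restrict V \<rho>) \<phi>s"] by fastforce
qed auto

lemma variables_restrict: "variables (restrict V \<rho> \<phi>) \<subseteq> variables \<phi> \<inter> V"
  using literals_restrict[of V \<rho> \<phi>] unfolding variables_def by force

lemma depth_restrict: "is_constant (restrict V \<rho> \<phi>) \<or> depth (restrict V \<rho> \<phi>) \<le> depth \<phi>"
proof (induction \<phi>)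
  case (Gate c \<phi>s)
  obtain n where n: "depth (Gate c \<phi>s) = Suc n"
    using depth_Gate_ne_0 gr0_implies_Suc by blast
  then have "\<forall>\<phi>\<in>set \<phi>s. depth \<phi> \<le> n"
    using depth_Gate_le_iff by (metis order_refl)
  then have "\<forall>\<psi>\<in>set (map (restrict V \<rho>) \<phi>s). is_constant \<psi> \<or> depth \<psi> \<le> n"
    using Gate by fastforce
  then show ?case
    unfolding n restrict.simps by (rule depth_join)
qed (auto simp: is_constant_def)

lemma reduced_restrict: "order2 \<phi> \<Longrightarrow> reduced (restrict V \<rho> \<phi>)"
proof (induction \<phi>)
  case (Gate c \<phi>s)
  \<comment> \<open>Restriction shrinks the set of variables and does not increase the depth, unless
    the result is a constant; then it has no variables and is compatible with everything.\<close>
  have "compatible (restrict V \<rho> \<phi>) (restrict V \<rho> \<psi>)" if "compatible \<phi> \<psi>" for \<phi> \<psi>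
    using that depth_restrict[of V \<rho> \<phi>] depth_restrict[of V \<rho> \<psi>]
      variables_restrict[of V \<rho> \<phi>] variables_restrict[of V \<rho> \<psi>] variables_constant
    unfolding compatible_def by (smt (verit) disjoint_iff empty_iff in_mono IntE order_trans)
  then have "sorted_wrt compatible (map (restrict V \<rho>) \<phi>s)"
    unfolding sorted_wrt_map using Gate.prems by (auto intro: sorted_wrt_mono_rel[rotated])
  then show ?case
    using Gate unfolding restrict.simps by (intro reduced_join) auto
qed (auto simp: reduced_def is_constant_def)

fun leaves_in :: "'v set \<Rightarrow> 'v formula \<Rightarrow> nat" where
  "leaves_in V (Lit s x) = of_bool (x \<in> V)"
| "leaves_in V (Gate c \<phi>s) = (\<Sum>\<phi>\<leftarrow>\<phi>s. leaves_in V \<phi>)"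

lemma num_leaves_restrict: "num_leaves (restrict V \<rho> \<phi>) \<le> leaves_in V \<phi>"
proof (induction \<phi>)
  case (Gate c \<phi>s)
  have "num_leaves (restrict V \<rho> (Gate c \<phi>s)) \<le> (\<Sum>\<phi>\<leftarrow>\<phi>s. num_leaves (restrict V \<rho> \<phi>))"
    using num_leaves_join[of c "map (restrict V \<rho>) \<phi>s"] by (simp add: o_def)
  also have "\<dots> \<le> (\<Sum>\<phi>\<leftarrow>\<phi>s. leaves_in V \<phi>)"
    using Gate by (intro sum_list_mono) simp
  finally show ?case
    by simp
qed auto

text \<open>The blocks are disjoint, so each leaf is counted for at most one of them.\<close>

lemma sum_leaves_in_le:
  assumes "finite P" "disjoint P"
  shows "(\<Sum>B\<in>P. leaves_in B \<phi>) \<le> num_leaves \<phi>"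
proof (induction \<phi>)
  case (Lit s x)
  have "card {B \<in> P. x \<in> B} \<le> 1"
    using assms by (auto simp: card_le_Suc0_iff_eq dest: disjointD)
  then show ?case
    using assms(1) by (simp add: of_bool_def sum.If_cases Int_def)
next
  case (Gate c \<phi>s)
  have "(\<Sum>B\<in>P. leaves_in B (Gate c \<phi>s)) = (\<Sum>\<phi>\<leftarrow>\<phi>s. \<Sum>B\<in>P. leaves_in B \<phi>)"
    by (induction \<phi>s) (simp_all add: sum.distrib)
  also have "\<dots> \<le> (\<Sum>\<phi>\<leftarrow>\<phi>s. num_leaves \<phi>)"
    using Gate by (intro sum_list_mono) simp
  finally show ?case
    by simp
qed


subsection \<open>Normal forms\<close>

text \<open>Parametrized by the outer connective, so that one argument serves both DNF and
  CNF.\<close>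

definition is_NF :: "connective \<Rightarrow> 'v formula \<Rightarrow> bool" where
  "is_NF c \<phi> \<longleftrightarrow>
     is_flat (dual c) \<phi> \<or> (\<exists>\<phi>s. \<phi> = Gate c \<phi>s \<and> (\<forall>\<psi>\<in>set \<phi>s. is_flat (dual c) \<psi>))"

lemma is_DNF_eq_is_NF: "is_DNF = is_NF Disj"
  by (simp add: fun_eq_iff is_DNF_def is_NF_def)

lemma is_CNF_eq_is_NF: "is_CNF = is_NF Conj"
  by (simp add: fun_eq_iff is_CNF_def is_NF_def)

lemma alternating_if_is_flat: "is_flat c \<phi> \<Longrightarrow> alternating \<phi>"
  by (fastforce simp: is_flat_def)

lemma depth_if_is_flat: "is_flat c \<phi> \<Longrightarrow> depth \<phi> \<le> 1"
  by (fastforce simp: is_flat_def)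

lemma is_flat_if_depth_le_1:
  assumes "alternating (Gate c \<phi>s)" "\<phi> \<in> set \<phi>s" "depth \<phi> \<le> 1"
  shows "is_flat (dual c) \<phi>"
proof (cases \<phi>)
  case (Gate d \<psi>s)
  then have "d = dual c"
    using assms(1,2) by (auto simp: eq_dual_iff)
  moreover have "\<forall>\<psi>\<in>set \<psi>s. \<exists>s x. \<psi> = Lit s x"
    using assms(3) Gate by (simp add: depth_eq_0_iff)
  ultimately show ?thesis
    using Gate by (simp add: is_flat_def)
qed (simp add: is_flat_def)

text \<open>A normal form has depth at most 2, and its inner gates carry the connective opposite to
  the outer one.\<close>

lemma UF2_if_is_NF:
  assumes "is_NF c \<phi>" "unate_formula \<phi>"
  shows "UF2 \<phi>"
proof -
  have neq: "\<psi> \<noteq> Gate c \<psi>s" if "is_flat (dual c) \<psi>" for \<psi> :: "'a formula" and \<psi>s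
    using that by (auto simp: is_flat_def)
  have "alternating \<phi>"
    using assms(1) neq alternating_if_is_flat unfolding is_NF_def by fastforce
  moreover have "depth \<phi> \<le> Suc 1"
    using assms(1) unfolding is_NF_def
    by (metis depth_Gate_le_iff depth_if_is_flat le_SucI)
  ultimately show ?thesis
    using assms(2) by (simp add: UF2_iff order2_if_depth_le_2)
qed

lemma is_flat_join_Lit: "is_flat c (join c (map (\<lambda>x. Lit (\<sigma> x) x) xs))"
proof -
  have "concat (map (flatten c) (map (\<lambda>x. Lit (\<sigma> x) x) xs)) = map (\<lambda>x. Lit (\<sigma> x) x) xs"
    by (induction xs) simp_all
  moreover have "Gate (dual c) [] \<notin> set (map (\<lambda>x. Lit (\<sigma> x) x) xs)"
    by auto
  ultimately show ?thesis
    by (auto simp: join_def is_flat_def split: list.split)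
qed

lemma is_NF_join:
  assumes "\<forall>\<phi>\<in>set \<phi>s. is_flat (dual c) \<phi>"
  shows "is_NF c (join c \<phi>s)"
proof -
  have "flatten c \<phi> = [\<phi>]" if "is_flat (dual c) \<phi>" for \<phi> :: "'a formula"
    using that by (auto simp: is_flat_def)
  then have "concat (map (flatten c) \<phi>s) = \<phi>s"
    using assms by (induction \<phi>s) simp_all
  \<comment> \<open>An empty clause is absorbing and becomes the result; without children it is flat
    vacuously.\<close>
  moreover have "is_NF c (Gate (dual c) [])"
    by (simp add: is_NF_def is_flat_def)
  ultimately show ?thesis
    using assms by (simp add: join_def is_NF_def split: list.split)
qed

section \<open>Existence of unate normal forms\<close>

lemma eval_cong_variables:
  "(\<And>x. x \<in> variables \<phi> \<Longrightarrow> a x = b x) \<Longrightarrow> eval \<phi> a = eval \<phi> b"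
proof (induction \<phi>)
  case (Gate c \<phi>s)
  then have "eval \<phi> a = eval \<phi> b" if "\<phi> \<in> set \<phi>s" for \<phi>
    using that by auto
  then show ?case
    by (cases c) auto
qed simp

lemma bool_fun_eval:
  assumes "finite X" "variables \<phi> \<subseteq> X"
  shows "bool_fun X (eval \<phi>)"
  unfolding bool_fun_def
proof (intro conjI allI impI)
  fix a b :: "'a \<Rightarrow> bool" assume "\<forall>x\<in>X. a x = b x"
  then show "eval \<phi> a = eval \<phi> b"
    using assms(2) by (intro eval_cong_variables) auto
qed (use assms(1) in simp)

text \<open>Gates are monotone and every leaf has the polarity given by \<open>\<sigma>\<close>, so
  a formula cannot become false when more variables agree with \<open>\<sigma>\<close>.\<close>

lemma eval_mono:
  assumes "literals \<phi> \<subseteq> {(\<sigma> x, x) |x. True}"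
    and "\<And>x. x \<in> variables \<phi> \<Longrightarrow> a x = \<sigma> x \<Longrightarrow> b x = \<sigma> x"
    and "eval \<phi> a"
  shows "eval \<phi> b"
  using assms
proof (induction \<phi>)
  case (Gate c \<phi>s)
  have "eval \<phi> b" if "\<phi> \<in> set \<phi>s" "eval \<phi> a" for \<phi>
    using that Gate.prems(1,2) by (intro Gate.IH) auto
  then show ?case
    using Gate.prems(3) by (cases c) auto
qed auto

lemma proper_gates_variables: "proper_gates \<phi> \<Longrightarrow> variables \<phi> \<noteq> {}"
proof (induction \<phi>)
  case (Gate c \<phi>s)
  then have "hd \<phi>s \<in> set \<phi>s"
    by (intro hd_in_set) auto
  then show ?case
    using Gate by auto
qed simp

text \<open>A unate function is monotone up to the polarities \<open>\<sigma>\<close>. It is the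
  combination by \<open>c\<close> of one clause for each set \<open>S\<close> of variables whose
  literals suffice to force the value absorbing for \<open>c\<close>. Redundant clauses are
  harmless, as only existence matters.\<close>

lemma ex_is_NF:
  assumes X: "bool_fun X f" and unate: "unate X f" and nonconst: "f a \<noteq> f b"
  shows "\<exists>\<phi>. unate_formula \<phi> \<and> is_NF c \<phi> \<and> computes X \<phi> f"
proof -
  obtain \<phi>\<^sub>0 where \<phi>\<^sub>0: "unate_formula \<phi>\<^sub>0" "variables \<phi>\<^sub>0 \<subseteq> X" "\<And>a. eval \<phi>\<^sub>0 a = f a"
    using unate by (auto simp: unate_def computes_def)
  \<comment> \<open>Variables that do not occur in \<open>\<phi>\<^sub>0\<close> get negative
    polarity by default.\<close>
  define \<sigma> where "\<sigma> x \<longleftrightarrow> (True, x) \<in> literals \<phi>\<^sub>0" for x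
  have "s = \<sigma> x" if "(s, x) \<in> literals \<phi>\<^sub>0" for s x
    using that \<phi>\<^sub>0(1) by (cases s) (auto simp: unate_formula_def \<sigma>_def)
  then have lits: "literals \<phi>\<^sub>0 \<subseteq> {(\<sigma> x, x) |x. True}"
    by auto
  \<comment> \<open>\<open>v\<close> is the value absorbing for \<open>c\<close>, and
    \<open>(a x = \<sigma> x) = v\<close> says that the literal of \<open>x\<close> has value
    \<open>v\<close> under \<open>a\<close>. For \<open>v = False\<close> monotonicity is applied in
    the reverse direction.\<close>
  define v where "v \<longleftrightarrow> c = Disj"
  have mono: "f b = v"
    if le: "\<And>x. x \<in> X \<Longrightarrow> (a x = \<sigma> x) = v \<Longrightarrow> (b x = \<sigma> x) = v" and "f a = v" for a b
  proof (cases v)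
    case True
    then show ?thesis
      using eval_mono[OF lits, of a b] that \<phi>\<^sub>0(2,3) by auto
  next
    case False
    then show ?thesis
      using eval_mono[OF lits, of b a] that \<phi>\<^sub>0(2,3) by auto
  qed

  \<comment> \<open>The assignment under which exactly the literals of variables in \<open>S\<close>
    have value \<open>v\<close>.\<close>
  define ind where "ind S x \<longleftrightarrow> \<sigma> x = (v = (x \<in> S))" for S x
  have ind: "(ind S x = \<sigma> x) = v \<longleftrightarrow> x \<in> S" for S x
    unfolding ind_def by argo
  have "finite X"
    using X by (simp add: bool_fun_def)
  define T where "T = {S \<in> Pow X. f (ind S) = v}"
  have "finite T"
    using \<open>finite X\<close> by (simp add: T_def)
  then obtain Ss where Ss: "set Ss = T"
    using finite_list by blast
  have "\<forall>S. \<exists>xs. S \<in> T \<longrightarrow> set xs = S"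
    using \<open>finite X\<close> finite_list unfolding T_def by (metis (lifting) Pow_iff finite_subset mem_Collect_eq)
  then obtain l where l: "\<And>S. S \<in> T \<Longrightarrow> set (l S) = S"
    by metis
  define clause where "clause S = join (dual c) (map (\<lambda>x. Lit (\<sigma> x) x) (l S))" for S
  define \<phi> where "\<phi> = join c (map clause Ss)"

  have "f a = v \<longleftrightarrow> (\<exists>S\<in>T. \<forall>x\<in>S. (a x = \<sigma> x) = v)" for a
  proof
    assume a: "f a = v"
    \<comment> \<open>On \<open>X\<close> this choice of \<open>S\<close> makes \<open>ind S\<close>
      agree with \<open>a\<close>.\<close>
    define S where "S = {x \<in> X. (a x = \<sigma> x) = v}"
    have "a x = ind S x" if "x \<in> X" for x
      using ind[of S x] that unfolding S_def by auto
    then have "f (ind S) = v"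
      using X a unfolding bool_fun_def by metis
    then show "\<exists>S\<in>T. \<forall>x\<in>S. (a x = \<sigma> x) = v"
      by (intro bexI[of _ S]) (auto simp: T_def S_def)
  next
    assume "\<exists>S\<in>T. \<forall>x\<in>S. (a x = \<sigma> x) = v"
    then obtain S where "f (ind S) = v" "\<forall>x\<in>S. (a x = \<sigma> x) = v"
      by (auto simp: T_def)
    then show "f a = v"
      using mono[of "ind S" a] ind by auto
  qed
  moreover have "eval (clause S) a = v \<longleftrightarrow> (\<forall>x\<in>S. (a x = \<sigma> x) = v)" if "S \<in> T" for S a
    unfolding v_def clause_def eval_join eval_Gate_dual_iff using l[OF that] by simp
  then have "eval \<phi> a = v \<longleftrightarrow> (\<exists>S\<in>T. \<forall>x\<in>S. (a x = \<sigma> x) = v)" for a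
    unfolding v_def \<phi>_def eval_join eval_Gate_iff using Ss by simp
  ultimately have eval: "eval \<phi> a = f a" for a
    by metis

  have "literals (clause S) \<subseteq> {(\<sigma> x, x) |x. x \<in> X}" if "S \<in> T" for S
  proof -
    have "literals (clause S) \<subseteq> (\<Union>x\<in>S. {(\<sigma> x, x)})"
      using literals_join[of "dual c" "map (\<lambda>x. Lit (\<sigma> x) x) (l S)"] l[OF that]
      by (simp add: clause_def)
    also have "\<dots> \<subseteq> {(\<sigma> x, x) |x. x \<in> X}"
      using that by (auto simp: T_def)
    finally show ?thesis .
  qed
  then have lits: "literals \<phi> \<subseteq> {(\<sigma> x, x) |x. x \<in> X}"
    using literals_join[of c "map clause Ss"] Ss by (fastforce simp: \<phi>_def)

  have "reduced (clause S)" for S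
    unfolding clause_def
    by (intro reduced_join sorted_wrt_compatible_if_depth_le) (auto simp: reduced_def)
  moreover have "is_constant (clause S) \<or> depth (clause S) \<le> 1" for S
    using depth_join[of "map (\<lambda>x. Lit (\<sigma> x) x) (l S)" 0 "dual c"] by (simp add: clause_def)
  then have "compatible (clause S) (clause S')" for S S'
    unfolding compatible_def by (metis variables_constant inf_bot_left inf_bot_right)
  then have "sorted_wrt compatible (map clause Ss)"
    by (simp add: sorted_wrt_compatible_iff)
  ultimately have "reduced \<phi>"
    unfolding \<phi>_def by (intro reduced_join) auto
  \<comment> \<open>Since \<open>f\<close> is not constant, \<open>\<phi>\<close> is not an empty
    gate.\<close>
  then have "proper_gates \<phi>"
    using nonconst reduced_nonconstantD(1)[of \<phi> a b] by (simp add: eval)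
  then have "unate_formula \<phi>"
    using lits by (auto simp: unate_formula_def)
  moreover have "is_NF c \<phi>"
    unfolding \<phi>_def clause_def by (intro is_NF_join) (auto simp: is_flat_join_Lit)
  moreover have "computes X \<phi> f"
    using eval lits by (auto simp: computes_def variables_def)
  ultimately show ?thesis
    by blast
qed


subsection \<open>Decompositions\<close>

lemma L2_le: "UF2 \<phi> \<Longrightarrow> computes X \<phi> f \<Longrightarrow> L2 X f \<le> num_leaves \<phi>"
  unfolding L2_def by (rule Least_le) blast

text \<open>The given formula makes the set under \<open>LEAST\<close> nonempty, so that its value
  is meaningful.\<close>

lemma L2_attained:
  assumes "UF2 \<phi>" "computes X \<phi> f"
  obtains \<psi> where "UF2 \<psi>" "computes X \<psi> f" "num_leaves \<psi> = L2 X f"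
proof -
  have "\<exists>\<psi>. UF2 \<psi> \<and> computes X \<psi> f \<and> num_leaves \<psi> = L2 X f"
    unfolding L2_def by (rule LeastI_ex) (use assms in blast)
  then show ?thesis
    using that by blast
qed

text \<open>A variable of the nonempty block \<open>B\<close> can influence \<open>f\<close> only
  through the factor on \<open>B\<close>; were this constant, \<open>f\<close> would not depend on
  the variable.\<close>

lemma decomposition_factor_nonconstant:
  assumes dec: "decomposition c X f P F" and dep: "\<forall>x\<in>X. depends_on f x" and B: "B \<in> P"
  shows "\<exists>a b. F B a \<noteq> F B b"
proof (rule ccontr)
  assume const: "\<not> (\<exists>a b. F B a \<noteq> F B b)"
  have P: "partition_on X P"
    using dec by (simp add: decomposition_def)
  then obtain x where x: "x \<in> B"
    using B partition_onD3 by fastforce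
  then have "x \<in> X"
    using P B partition_onD1 by blast
  then obtain a where a: "f (a(x := True)) \<noteq> f (a(x := False))"
    using dep by (auto simp: depends_on_def)
  have "F B' (a(x := True)) = F B' (a(x := False))" if B': "B' \<in> P" for B'
  proof (cases "B' = B")
    case True
    then show ?thesis
      using const by blast
  next
    case False
    then have "x \<notin> B'"
      using P B B' x partition_onD2[OF P] by (auto dest: disjointD)
    moreover have "bool_fun B' (F B')"
      using dec B' by (simp add: decomposition_def)
    ultimately show ?thesis
      unfolding bool_fun_def by (metis fun_upd_other)
  qed
  then have "big c P (\<lambda>B. F B (a(x := True))) = big c P (\<lambda>B. F B (a(x := False)))"
    by (cases c) auto
  then show False
    using a dec by (simp add: decomposition_def)
qed

text \<open>Outside \<open>B\<close>, make every other factor neutral.\<close>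

lemma decomposition_factor_is_restriction:
  assumes dec: "decomposition c X f P F" and dep: "\<forall>x\<in>X. depends_on f x" and B: "B \<in> P"
  obtains \<rho> where "\<And>a. f (override_on \<rho> a B) = F B a"
proof -
  have P: "disjoint P"
    using dec by (auto simp: decomposition_def partition_on_def)
  \<comment> \<open>A factor that is not constant also takes the value neutral for
    \<open>c\<close>.\<close>
  have "\<exists>a. F B' a \<noteq> (c = Disj)" if "B' \<in> P" for B'
    using decomposition_factor_nonconstant[OF dec dep that] by metis
  then obtain \<alpha> where \<alpha>: "\<And>B'. B' \<in> P \<Longrightarrow> F B' (\<alpha> B') \<noteq> (c = Disj)"
    by metis
  \<comment> \<open>The assignments \<open>\<alpha> B'\<close> are glued along the blocks;
    disjointness makes the block of a variable unique.\<close>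
  define \<rho> where "\<rho> x = \<alpha> (THE B'. B' \<in> P \<and> x \<in> B') x" for x
  have \<rho>: "\<rho> x = \<alpha> B' x" if "B' \<in> P" "x \<in> B'" for B' x
  proof -
    have "(THE B'. B' \<in> P \<and> x \<in> B') = B'"
      using that P by (intro the_equality) (auto dest: disjointD)
    then show ?thesis
      by (simp add: \<rho>_def)
  qed
  have cong: "F B' a = F B' b" if "B' \<in> P" "\<forall>x\<in>B'. a x = b x" for B' a b
    using dec that by (simp add: decomposition_def bool_fun_def)
  have "f (override_on \<rho> a B) = F B a" for a
  proof -
    have "F B' (override_on \<rho> a B) \<noteq> (c = Disj)" if "B' \<in> P" "B' \<noteq> B" for B'
    proof -
      have "B' \<inter> B = {}"
        using that B P by (simp add: disjointD)
      then have "F B' (override_on \<rho> a B) = F B' (\<alpha> B')"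
        using that(1) \<rho> by (intro cong) (auto simp: override_on_def)
      then show ?thesis
        using \<alpha> that(1) by simp
    qed
    moreover have "F B (override_on \<rho> a B) = F B a"
      using B by (intro cong) auto
    moreover have "f (override_on \<rho> a B) = (c = Disj) \<longleftrightarrow>
        (\<exists>B'\<in>P. F B' (override_on \<rho> a B) = (c = Disj))"
      using dec big_iff by (simp add: decomposition_def)
    ultimately have "f (override_on \<rho> a B) = (c = Disj) \<longleftrightarrow> F B a = (c = Disj)"
      using B by metis
    then show ?thesis
      by argo
  qed
  then show ?thesis
    using that by blast
qed

text \<open>The restriction of \<open>\<phi>\<close> to \<open>B\<close> computes the factor, which
  is not constant, so the restriction is a genuine formula and not an empty gate.\<close>

lemma decomposition_factor_UF2:
  assumes dec: "decomposition c X f P F" and dep: "\<forall>x\<in>X. depends_on f x" and B: "B \<in> P"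
    and \<phi>: "UF2 \<phi>" "computes X \<phi> f"
  obtains \<psi> where "UF2 \<psi>" "computes B \<psi> (F B)" "num_leaves \<psi> \<le> leaves_in B \<phi>"
proof -
  obtain \<rho> where \<rho>: "\<And>a. f (override_on \<rho> a B) = F B a"
    using decomposition_factor_is_restriction[OF dec dep B] by blast
  define \<psi> where "\<psi> = restrict B \<rho> \<phi>"
  have eval: "eval \<psi> a = F B a" for a
    using \<phi>(2) \<rho> by (simp add: \<psi>_def eval_restrict computes_def)
  have "reduced \<psi>"
    unfolding \<psi>_def using \<phi>(1) by (intro reduced_restrict) (simp add: UF2_iff)
  then have "proper_gates \<psi>" "alternating \<psi>" "order2 \<psi>"
    using decomposition_factor_nonconstant[OF dec dep B] reduced_nonconstantD eval by metis+
  then have "UF2 \<psi>"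
    using literals_restrict[of B \<rho> \<phi>] \<phi>(1) by (auto simp: UF2_iff unate_formula_def \<psi>_def)
  moreover have "computes B \<psi> (F B)"
    using eval variables_restrict[of B \<rho> \<phi>] by (auto simp: computes_def \<psi>_def)
  moreover have "num_leaves \<psi> \<le> leaves_in B \<phi>"
    unfolding \<psi>_def by (rule num_leaves_restrict)
  ultimately show ?thesis
    using that by blast
qed

text \<open>The lower bound: each factor has an order-2 formula using at most the leaves of
  \<open>\<phi>\<close> in its block, and no leaf belongs to two blocks.\<close>

lemma sum_L2_le:
  assumes "finite X" "decomposition c X f P F" "\<forall>x\<in>X. depends_on f x"
    and \<phi>: "UF2 \<phi>" "computes X \<phi> f"
  shows "(\<Sum>B\<in>P. L2 B (F B)) \<le> num_leaves \<phi>"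
proof -
  have P: "partition_on X P"
    using assms(2) by (simp add: decomposition_def)
  have "L2 B (F B) \<le> leaves_in B \<phi>" if "B \<in> P" for B
    using decomposition_factor_UF2[OF assms(2,3) that \<phi>] L2_le order_trans by metis
  then have "(\<Sum>B\<in>P. L2 B (F B)) \<le> (\<Sum>B\<in>P. leaves_in B \<phi>)"
    by (rule sum_mono)
  also have "\<dots> \<le> num_leaves \<phi>"
    using finite_elements[OF assms(1) P] partition_onD2[OF P] by (rule sum_leaves_in_le)
  finally show ?thesis .
qed

text \<open>The upper bound: optimal formulas for the factors have pairwise disjoint variables, so
  after joining them siblings are compatible and polarities cannot clash. The formula
  \<open>\<phi>\<close> ensures that every factor has an order-2 formula at all.\<close>

lemma L2_le_sum:
  assumes "finite X" and dec: "decomposition c X f P F" and dep: "\<forall>x\<in>X. depends_on f x"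
    and \<phi>: "UF2 \<phi>" "computes X \<phi> f"
  shows "L2 X f \<le> (\<Sum>B\<in>P. L2 B (F B))"
proof -
  have P: "partition_on X P"
    using dec by (simp add: decomposition_def)
  have "\<exists>\<psi>. UF2 \<psi> \<and> computes B \<psi> (F B) \<and> num_leaves \<psi> = L2 B (F B)" if "B \<in> P" for B
    using decomposition_factor_UF2[OF dec dep that \<phi>] L2_attained by metis
  then obtain \<psi> where \<psi>: "\<And>B. B \<in> P \<Longrightarrow>
      UF2 (\<psi> B) \<and> computes B (\<psi> B) (F B) \<and> num_leaves (\<psi> B) = L2 B (F B)"
    by metis
  obtain Bs where Bs: "set Bs = P" "distinct Bs"
    using finite_distinct_list[OF finite_elements[OF assms(1) P]] by blast
  define \<chi> where "\<chi> = join c (map \<psi> Bs)"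
  have vars: "variables (\<psi> B) \<subseteq> B" if "B \<in> P" for B
    using \<psi>[OF that] by (simp add: computes_def)
  have eval: "eval \<chi> a = f a" for a
  proof -
    have "eval \<chi> a = big c P (\<lambda>B. F B a)"
      unfolding \<chi>_def eval_join using \<psi> Bs(1) by (cases c) (auto simp: computes_def)
    then show ?thesis
      using dec by (simp add: decomposition_def)
  qed
  have "compatible (\<psi> B) (\<psi> B')" if "B \<in> P" "B' \<in> P" "B \<noteq> B'" for B B'
  proof -
    have "B \<inter> B' = {}"
      using that partition_onD2[OF P] by (simp add: disjointD)
    then show ?thesis
      using vars that unfolding compatible_def by blast
  qed
  then have "sorted_wrt compatible (map \<psi> Bs)"
    unfolding sorted_wrt_compatible_iff using Bs by (auto simp: nth_eq_iff_index_eq)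
  then have "reduced \<chi>"
    unfolding \<chi>_def using \<psi> Bs(1)
    by (intro reduced_join) (auto simp: reduced_def UF2_iff unate_formula_def)
  \<comment> \<open>\<open>f\<close> is not constant because fixing variables turns it into a factor
    that is not constant.\<close>
  moreover obtain a b where "f a \<noteq> f b"
  proof -
    have "P \<noteq> {}"
      using dec by (auto simp: decomposition_def)
    then obtain B where B: "B \<in> P"
      by blast
    obtain \<rho> where "\<And>a. f (override_on \<rho> a B) = F B a"
      using decomposition_factor_is_restriction[OF dec dep B] by blast
    then show ?thesis
      using decomposition_factor_nonconstant[OF dec dep B] that by metis
  qed
  ultimately have \<chi>: "proper_gates \<chi>" "alternating \<chi>" "order2 \<chi>"
    using reduced_nonconstantD[of \<chi> a b] eval by simp_all
  have lits: "\<exists>B\<in>P. x \<in> B \<and> (s, x) \<in> literals (\<psi> B)" if "(s, x) \<in> literals \<chi>" for s x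
  proof -
    have "(s, x) \<in> (\<Union>\<phi>\<in>set (map \<psi> Bs). literals \<phi>)"
      using that literals_join unfolding \<chi>_def by (rule subsetD[rotated])
    then obtain B where B: "B \<in> P" "(s, x) \<in> literals (\<psi> B)"
      using Bs(1) by auto
    then have "x \<in> variables (\<psi> B)"
      by (force simp: variables_def)
    then show ?thesis
      using B vars by blast
  qed
  have "\<not> ((True, x) \<in> literals \<chi> \<and> (False, x) \<in> literals \<chi>)" for x
  proof
    assume x: "(True, x) \<in> literals \<chi> \<and> (False, x) \<in> literals \<chi>"
    then obtain B B' where B: "B \<in> P" "x \<in> B" "(True, x) \<in> literals (\<psi> B)"
      and B': "B' \<in> P" "x \<in> B'" "(False, x) \<in> literals (\<psi> B')"
      using lits by meson
    then have "B = B'"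
      using partition_onD2[OF P] by (auto dest: disjointD)
    then show False
      using B B' \<psi> by (auto simp: UF2_iff unate_formula_def)
  qed
  then have "UF2 \<chi>"
    using \<chi> by (simp add: UF2_iff unate_formula_def)
  moreover have "computes X \<chi> f"
    using eval lits unfolding computes_def variables_def partition_onD1[OF P] by fastforce
  ultimately have "L2 X f \<le> num_leaves \<chi>"
    by (rule L2_le)
  also have "\<dots> \<le> (\<Sum>B\<leftarrow>Bs. num_leaves (\<psi> B))"
    using num_leaves_join[of c "map \<psi> Bs"] by (simp add: \<chi>_def o_def)
  also have "\<dots> = (\<Sum>B\<in>P. L2 B (F B))"
    using Bs \<psi> by (auto simp: sum_list_distinct_conv_sum_set intro: sum.cong)
  finally show ?thesis .
qed

section \<open>Indecomposable functions\<close>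

lemma decomposable_if_disjoint_child:
  assumes X: "finite X" and \<phi>: "computes X (Gate c \<phi>s) f" "proper_gates (Gate c \<phi>s)"
    and i: "i < length \<phi>s"
    and disj: "\<And>j. j < length \<phi>s \<Longrightarrow> j \<noteq> i \<Longrightarrow> variables (\<phi>s ! i) \<inter> variables (\<phi>s ! j) = {}"
  shows "decomposable c X f"
proof -
  \<comment> \<open>The two blocks are \<open>V\<close> and \<open>X - V\<close>; the factors are
    the child at \<open>i\<close> and the gate formed by its siblings.\<close>
  define V where "V = variables (\<phi>s ! i)"
  define \<psi>s where "\<psi>s = take i \<phi>s @ drop (Suc i) \<phi>s"
  have set_\<phi>s: "set \<phi>s = insert (\<phi>s ! i) (set \<psi>s)"
    unfolding \<psi>s_def using i by (subst id_take_nth_drop[OF i]) auto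
  have vars: "variables (\<phi>s ! j) \<subseteq> X" if "j < length \<phi>s" for j
    using \<phi>(1) that nth_mem by (fastforce simp: computes_def)
  have "\<exists>j<length \<phi>s. j \<noteq> i \<and> \<psi> = \<phi>s ! j" if "\<psi> \<in> set \<psi>s" for \<psi>
  proof -
    consider "\<psi> \<in> set (take i \<phi>s)" | "\<psi> \<in> set (drop (Suc i) \<phi>s)"
      using \<open>\<psi> \<in> set \<psi>s\<close> by (auto simp: \<psi>s_def)
    then show ?thesis
    proof cases
      case 1
      then obtain k where "k < i" "\<psi> = \<phi>s ! k"
        by (auto simp: in_set_conv_nth)
      then show ?thesis
        using i by (intro exI[of _ k]) auto
    next
      case 2
      then obtain k where "k < length \<phi>s - Suc i" "\<psi> = \<phi>s ! (Suc i + k)"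
        by (auto simp: in_set_conv_nth)
      then show ?thesis
        by (intro exI[of _ "Suc i + k"]) auto
    qed
  qed
  then have vars_\<psi>s: "variables \<psi> \<subseteq> X - V" if "\<psi> \<in> set \<psi>s" for \<psi>
    using that vars disj unfolding V_def by blast
  obtain \<psi> where \<psi>: "\<psi> \<in> set \<psi>s"
  proof -
    have "length \<psi>s = length \<phi>s - 1"
      using i by (simp add: \<psi>s_def)
    then have "hd \<psi>s \<in> set \<psi>s"
      using \<phi>(2) by (intro hd_in_set) auto
    then show ?thesis
      by (rule that)
  qed
  have V: "V \<subseteq> X" "V \<noteq> {}"
    using vars[OF i] proper_gates_variables[of "\<phi>s ! i"] \<phi>(2) i by (auto simp: V_def)
  \<comment> \<open>Fan-in at least 2 provides a sibling, which has a variable because there are no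
    constants.\<close>
  have "X - V \<noteq> {}"
    using vars_\<psi>s[OF \<psi>] proper_gates_variables[of \<psi>] \<psi> \<phi>(2) set_\<phi>s by auto
  then have neq: "V \<noteq> X - V"
    using V(2) by blast
  define F where "F B = (if B = V then eval (\<phi>s ! i) else eval (Gate c \<psi>s))" for B
  have F: "F V = eval (\<phi>s ! i)" "F (X - V) = eval (Gate c \<psi>s)"
    using neq by (simp_all add: F_def)
  have "decomposition c X f {V, X - V} F"
    unfolding decomposition_def
  proof (intro conjI allI)
    show "partition_on X {V, X - V}"
      using V \<open>X - V \<noteq> {}\<close> by (auto simp: partition_on_def disjoint_def)
    show "card {V, X - V} > 1"
      using neq by simp
    have "bool_fun V (F V)"
      unfolding F(1) by (rule bool_fun_eval) (use finite_subset[OF V(1) X] in \<open>simp_all add: V_def\<close>)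
    moreover have "bool_fun (X - V) (F (X - V))"
      unfolding F(2) by (rule bool_fun_eval) (use X vars_\<psi>s in auto)
    ultimately show "\<forall>B\<in>{V, X - V}. bool_fun B (F B)"
      by simp
    show "f a = big c {V, X - V} (\<lambda>B. F B a)" for a
    proof -
      have "eval (Gate c \<phi>s) a = (c = Disj) \<longleftrightarrow>
          eval (\<phi>s ! i) a = (c = Disj) \<or> eval (Gate c \<psi>s) a = (c = Disj)"
        unfolding eval_Gate_iff set_\<phi>s by blast
      also have "\<dots> \<longleftrightarrow> big c {V, X - V} (\<lambda>B. F B a) = (c = Disj)"
        unfolding big_iff using F by simp
      finally show ?thesis
        using \<phi>(1) unfolding computes_def by metis
    qed
  qed
  then show ?thesis
    unfolding decomposable_def by blast
qed

lemma is_NF_if_indecomposable: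
  assumes X: "finite X" and \<phi>: "UF2 \<phi>" "computes X \<phi> f" and indec: "\<And>c. \<not> decomposable c X f"
  shows "\<exists>c. is_NF c \<phi>"
proof (cases \<phi>)
  case (Gate c \<phi>s)
  have "depth (\<phi>s ! i) \<le> 1" if i: "i < length \<phi>s" for i
  proof (rule ccontr)
    assume "\<not> depth (\<phi>s ! i) \<le> 1"
    moreover have "compatible (\<phi>s ! i) (\<phi>s ! j)" if "j < length \<phi>s" "j \<noteq> i" for j
      using \<phi>(1) Gate i that by (simp add: UF2_iff sorted_wrt_compatible_iff)
    ultimately have "variables (\<phi>s ! i) \<inter> variables (\<phi>s ! j) = {}"
      if "j < length \<phi>s" "j \<noteq> i" for j
      using that by (auto simp: compatible_def)
    then have "decomposable c X f"
      using X \<phi> Gate i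
      by (intro decomposable_if_disjoint_child) (auto simp: UF2_iff unate_formula_def)
    then show False
      using indec by blast
  qed
  then have "\<forall>\<psi>\<in>set \<phi>s. depth \<psi> \<le> 1"
    by (metis in_set_conv_nth)
  \<comment> \<open>By alternation a child that is a gate carries the connective
    \<open>dual c\<close>, so the root label decides which normal form it is.\<close>
  then have "\<forall>\<psi>\<in>set \<phi>s. is_flat (dual c) \<psi>"
    using \<phi>(1) Gate is_flat_if_depth_le_1 by (metis UF2_iff)
  then show ?thesis
    using Gate by (auto simp: is_NF_def)
qed (simp add: is_NF_def is_flat_def)

theorem mainTheorem15:
  fixes X :: "'v set" and f :: "('v \<Rightarrow> bool) \<Rightarrow> bool"
  assumes "bool_fun X f"
    and "\<forall>x\<in>X. depends_on f x"
    and "unate X f"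
  shows "(\<forall>c P F. maximal_decomposition c X f P F \<longrightarrow>
            L2 X f = Min {\<Sum>B\<in>P. L2 B (F B), uDNF_size X f, uCNF_size X f}) \<and>
         (\<not> decomposable Conj X f \<and> \<not> decomposable Disj X f \<longrightarrow>
            L2 X f = min (uDNF_size X f) (uCNF_size X f))"
proof -
  have "finite X"
    using assms(1) by (simp add: bool_fun_def)
  obtain \<phi>\<^sub>0 where "proper_gates \<phi>\<^sub>0" "variables \<phi>\<^sub>0 \<subseteq> X"
    using assms(3) by (auto simp: unate_def unate_formula_def computes_def)
  \<comment> \<open>A unate formula contains a variable, and dependence on it makes \<open>f\<close>
    non-constant, as the existence of normal forms requires.\<close>
  then obtain x where "x \<in> X"
    using proper_gates_variables by blast
  then obtain a b where nonconst: "f a \<noteq> f b"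
    using assms(2) unfolding depends_on_def by blast

  define NF_size where "NF_size c =
      (LEAST s. \<exists>\<phi>. unate_formula \<phi> \<and> is_NF c \<phi> \<and> computes X \<phi> f \<and> num_leaves \<phi> = s)" for c
  have NF_size: "uDNF_size X f = NF_size Disj" "uCNF_size X f = NF_size Conj"
    by (simp_all add: NF_size_def uDNF_size_def uCNF_size_def is_DNF_eq_is_NF is_CNF_eq_is_NF)
  have ex_NF: "\<exists>\<phi>. unate_formula \<phi> \<and> is_NF c \<phi> \<and> computes X \<phi> f \<and> num_leaves \<phi> = NF_size c" for c
    unfolding NF_size_def
    by (rule LeastI_ex) (use ex_is_NF[OF assms(1,3) nonconst, of c] in blast)
  have NF_size_le: "NF_size c \<le> num_leaves \<phi>"
    if "unate_formula \<phi>" "is_NF c \<phi>" "computes X \<phi> f" for c \<phi>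
    unfolding NF_size_def by (rule Least_le) (use that in blast)
  have L2_le_NF: "L2 X f \<le> NF_size c" for c
    using ex_NF[of c] UF2_if_is_NF L2_le by metis
  obtain \<phi> where \<phi>: "UF2 \<phi>" "computes X \<phi> f" "num_leaves \<phi> = L2 X f"
    using ex_NF[of Disj] UF2_if_is_NF L2_attained by metis

  have "L2 X f = Min {\<Sum>B\<in>P. L2 B (F B), uDNF_size X f, uCNF_size X f}"
    if "maximal_decomposition c X f P F" for c P F
  proof -
    have dec: "decomposition c X f P F"
      using that by (simp add: maximal_decomposition_def)
    have "L2 X f = (\<Sum>B\<in>P. L2 B (F B))"
      using sum_L2_le[OF \<open>finite X\<close> dec assms(2) \<phi>(1,2)] \<phi>(3)
        L2_le_sum[OF \<open>finite X\<close> dec assms(2) \<phi>(1,2)] by simp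
    \<comment> \<open>Normal forms are order-2 formulas, so neither of their sizes is below the
      sum.\<close>
    then show ?thesis
      using L2_le_NF[of Disj] L2_le_NF[of Conj] by (simp add: NF_size)
  qed
  moreover have "L2 X f = min (uDNF_size X f) (uCNF_size X f)"
    if "\<not> decomposable Conj X f" "\<not> decomposable Disj X f"
  proof -
    have "\<not> decomposable c X f" for c
      using that by (cases c) simp_all
    then obtain c where "is_NF c \<phi>"
      using is_NF_if_indecomposable[OF \<open>finite X\<close> \<phi>(1,2)] by blast
    \<comment> \<open>The optimal order-2 formula \<open>\<phi>\<close> is itself a normal
      form.\<close>
    then have "NF_size c \<le> L2 X f"
      using NF_size_le \<phi> by (metis UF2_iff)
    then show ?thesis
      using L2_le_NF[of Disj] L2_le_NF[of Conj] by (cases c) (simp_all add: NF_size)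
  qed
  ultimately show ?thesis
    by blast
qed

end
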